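(* Let $a,b$ be nonzero real numbers with $ab\neq -4$, let $\alpha,\beta$ be the roots of $x^2-abx-ab=0$, and let $\widetilde{Q}_n=Q_n+\varepsilon Q_{n+1}$ be the $n$th bi-periodic dual Fibonacci quaternion. Put $$\alpha^{\ast}=a+\alpha i+\frac{a}{ab}\alpha^2 j+\frac{1}{ab}\alpha^3 k,\qquad \beta^{\ast}=a+\beta i+\frac{a}{ab}\beta^2 j+\frac{1}{ab}\beta^3 k,$$ $$\alpha^{\ast\ast}=1+\frac{a}{ab}\alpha i+\frac{1}{ab}\alpha^2 j+\frac{a}{(ab)^2}\alpha^3 k,\qquad \beta^{\ast\ast}=1+\frac{a}{ab}\beta i+\frac{1}{ab}\beta^2 j+\frac{a}{(ab)^2}\beta^3 k.$$ Then for every integer $n\ge 0$: $$\widetilde{Q}_n=\frac{1}{(ab)^{\lfloor n/2\rfloor}}\left(\frac{\alpha^{\ast}\alpha^{n}-\beta^{\ast}\beta^{n}}{\alpha-\beta}\right)+\varepsilon\,\frac{1}{(ab)^{\lfloor (n+1)/2\rfloor}}\left(\frac{\alpha^{\ast\ast}\alpha^{n+1}-\beta^{\ast\ast}\beta^{n+1}}{\alpha-\beta}\right)\quad\text{if } n \text{ is even},$$ $$\widetilde{Q}_n=\frac{1}{(ab)^{\lfloor n/2\rfloor}}\left(\frac{\alpha^{\ast\ast}\alpha^{n}-\beta^{\ast\ast}\beta^{n}}{\alpha-\beta}\right)+\varepsilon\,\frac{1}{(ab)^{\lfloor (n+1)/2\rfloor}}\left(\frac{\alpha^{\ast}\alpha^{n+1}-\beta^{\ast}\beta^{n+1}}{\alpha-\beta}\right)\quad\text{if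 } n \text{ is odd}.$$
   Context: For nonzero real numbers $a,b$, the bi-periodic Fibonacci numbers are defined by $F_0=0$, $F_1=1$ and, for $n\ge 2$, $F_n=aF_{n-1}+F_{n-2}$ if $n$ is even, $F_n=bF_{n-1}+F_{n-2}$ if $n$ is odd. The bi-periodic Fibonacci quaternions are $Q_n=F_n+F_{n+1}i+F_{n+2}j+F_{n+3}k$, where $i,j,k$ are the quaternion units: $i^2=j^2=k^2=ijk=-1$. The dual unit $\varepsilon\neq 0$ satisfies $\varepsilon^2=0$ and commutes with quaternions; a dual quaternion is an expression $q+\varepsilon q^{\ast}$ with $q,q^{\ast}$ quaternions. The bi-periodic dual Fibonacci quaternions are $\widetilde{Q}_n=Q_n+\varepsilon Q_{n+1}$. The numbers $\alpha,\beta$ are the two roots of $x^2-abx-ab=0$, so $\alpha+\beta=ab$ and $\alpha\beta=-ab$; if they are non-real, all expressions are read in quaternions with complex coefficients (scalars being central and distinct from the unit $i$). *)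

theory Defs
  imports Complex_Main
begin

datatype 'a quaternion = Quat (qre: 'a) (qim1: 'a) (qim2: 'a) (qim3: 'a)

instantiation quaternion :: (comm_ring_1) ring_1
begin

definition "0 = Quat 0 0 0 0"

definition "1 = Quat 1 0 0 0"

definition
  "p + q = Quat (qre p + qre q) (qim1 p + qim1 q) (qim2 p + qim2 q) (qim3 p + qim3 q)"

definition
  "p - q = Quat (qre p - qre q) (qim1 p - qim1 q) (qim2 p - qim2 q) (qim3 p - qim3 q)"

definition "- q = Quat (- qre q) (- qim1 q) (- qim2 q) (- qim3 q)"

definition
  "p * q = Quat
     (qre p * qre q - qim1 p * qim1 q - qim2 p * qim2 q - qim3 p * qim3 q)
     (qre p * qim1 q + qim1 p * qre q + qim2 p * qim3 q - qim3 p * qim2 q)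
     (qre p * qim2 q - qim1 p * qim3 q + qim2 p * qre q + qim3 p * qim1 q)
     (qre p * qim3 q + qim1 p * qim2 q - qim2 p * qim1 q + qim3 p * qre q)"

instance
  by standard
    (simp_all add: zero_quaternion_def one_quaternion_def plus_quaternion_def
      minus_quaternion_def uminus_quaternion_def times_quaternion_def
      quaternion.expand algebra_simps)

end

lemmas quaternion_defs =
  zero_quaternion_def one_quaternion_def plus_quaternion_def
  minus_quaternion_def uminus_quaternion_def times_quaternion_def

definition qi :: "'a::comm_ring_1 quaternion" where "qi = Quat 0 1 0 0"
definition qj :: "'a::comm_ring_1 quaternion" where "qj = Quat 0 0 1 0"
definition qk :: "'a::comm_ring_1 quaternion" where "qk = Quat 0 0 0 1"

text \<open>Scalars are a subring of the quaternions. Over the complex numbers, the scalar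
  \<open>quat_of \<i>\<close> is central and different from the quaternion unit \<open>qi\<close>.\<close>

definition quat_of :: "'a::comm_ring_1 \<Rightarrow> 'a quaternion"
  where "quat_of c = Quat c 0 0 0"

definition scaleQ :: "'a::comm_ring_1 \<Rightarrow> 'a quaternion \<Rightarrow> 'a quaternion"  (infixr \<open>*\<^sub>Q\<close> 75)
  where "c *\<^sub>Q q = quat_of c * q"

lemma quaternion_units:
  "qi * qi = - (1 :: 'a::comm_ring_1 quaternion)"
  "qj * qj = - (1 :: 'a quaternion)"
  "qk * qk = - (1 :: 'a quaternion)"
  "qi * qj * qk = - (1 :: 'a quaternion)"
  by (simp_all add: qi_def qj_def qk_def quaternion_defs)

lemma quat_of_central: "quat_of c * q = q * quat_of c"
  by (simp add: quat_of_def quaternion_defs mult.commute)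

lemma quaternion_basis:
  "Quat x y z w = quat_of x + y *\<^sub>Q qi + z *\<^sub>Q qj + w *\<^sub>Q qk"
  by (simp add: scaleQ_def quat_of_def qi_def qj_def qk_def quaternion_defs)

text \<open>\<open>Dual x y\<close> is \<open>x + \<epsilon> y\<close>, where \<open>\<epsilon>\<close> commutes with all elements of the ring
  \<open>'a\<close>; dual quaternions are dual numbers with coefficients in the quaternions.\<close>

datatype 'a dual_number = Dual (real_part: 'a) (dual_part: 'a)

instantiation dual_number :: (ring_1) ring_1
begin

definition "0 = Dual 0 0"

definition "1 = Dual 1 0"

definition "x + y = Dual (real_part x + real_part y) (dual_part x + dual_part y)"

definition "x - y = Dual (real_part x - real_part y) (dual_part x - dual_part y)"

definition "- x = Dual (- real_part x) (- dual_part x)"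

definition
  "x * y = Dual (real_part x * real_part y)
     (real_part x * dual_part y + dual_part x * real_part y)"

instance
  by standard
    (simp_all add: zero_dual_number_def one_dual_number_def plus_dual_number_def
      minus_dual_number_def uminus_dual_number_def times_dual_number_def
      dual_number.expand algebra_simps)

end

lemmas dual_number_defs =
  zero_dual_number_def one_dual_number_def plus_dual_number_def
  minus_dual_number_def uminus_dual_number_def times_dual_number_def

definition dual_of :: "'a::ring_1 \<Rightarrow> 'a dual_number"
  where "dual_of x = Dual x 0"

definition dual_unit :: "'a::ring_1 dual_number"  (\<open>\<epsilon>\<close>)
  where "\<epsilon> = Dual 0 1"

lemma dual_unit_props:
  "\<epsilon> \<noteq> (0 :: 'a::ring_1 dual_number)"
  "\<epsilon> * \<epsilon> = (0 :: 'a dual_number)"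
  "\<epsilon> * dual_of x = dual_of x * (\<epsilon> :: 'a dual_number)"
  by (simp_all add: dual_unit_def dual_of_def dual_number_defs)

lemma dual_number_basis: "Dual x y = dual_of x + \<epsilon> * dual_of y"
  by (simp add: dual_unit_def dual_of_def dual_number_defs)

fun biperiodic_fib :: "real \<Rightarrow> real \<Rightarrow> nat \<Rightarrow> real" where
  "biperiodic_fib a b 0 = 0"
| "biperiodic_fib a b (Suc 0) = 1"
| "biperiodic_fib a b (Suc (Suc n)) =
     (if even (Suc (Suc n)) then a else b) * biperiodic_fib a b (Suc n) + biperiodic_fib a b n"

definition biperiodic_fib_quat :: "real \<Rightarrow> real \<Rightarrow> nat \<Rightarrow> real quaternion" where
  "biperiodic_fib_quat a b n =
     quat_of (biperiodic_fib a b n) + biperiodic_fib a b (n + 1) *\<^sub>Q qi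
       + biperiodic_fib a b (n + 2) *\<^sub>Q qj + biperiodic_fib a b (n + 3) *\<^sub>Q qk"

definition biperiodic_dual_fib_quat ::
    "real \<Rightarrow> real \<Rightarrow> nat \<Rightarrow> real quaternion dual_number" where
  "biperiodic_dual_fib_quat a b n =
     dual_of (biperiodic_fib_quat a b n) + \<epsilon> * dual_of (biperiodic_fib_quat a b (n + 1))"

text \<open>Since the roots may be non-real, Binet-type formulas live in the dual quaternions with
  complex coefficients. The real dual quaternions embed there coefficientwise, so that for real
  roots an identity between complexifications is the identity between the real ones.\<close>

definition complexify :: "real quaternion dual_number \<Rightarrow> complex quaternion dual_number"
  where "complexify = map_dual_number (map_quaternion complex_of_real)"

lemma inj_complexify: "inj complexify"
  unfolding complexify_def
  by (intro dual_number.inj_map quaternion.inj_map inj_of_real)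

lemma complexify_ring_hom:
  "complexify 1 = 1"
  "complexify (x + y) = complexify x + complexify y"
  "complexify (x * y) = complexify x * complexify y"
  by (simp_all add: complexify_def dual_number_defs quaternion_defs
      dual_number.map_sel quaternion.map_sel)

text \<open>For a root \<open>x\<close>, these are the quaternions written \<open>x\<^sup>*\<close> and \<open>x\<^sup>*\<^sup>*\<close>.\<close>

definition star_quat :: "real \<Rightarrow> real \<Rightarrow> complex \<Rightarrow> complex quaternion" where
  "star_quat a b x =
     quat_of (of_real a) + x *\<^sub>Q qi
       + (of_real a / of_real (a * b) * x ^ 2) *\<^sub>Q qj
       + (1 / of_real (a * b) * x ^ 3) *\<^sub>Q qk"

definition star_star_quat :: "real \<Rightarrow> real \<Rightarrow> complex \<Rightarrow> complex quaternion" where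
  "star_star_quat a b x =
     1 + (of_real a / of_real (a * b) * x) *\<^sub>Q qi
       + (1 / of_real (a * b) * x ^ 2) *\<^sub>Q qj
       + (of_real a / of_real (a * b) ^ 2 * x ^ 3) *\<^sub>Q qk"

end

theory Submission imports Defs begin

text \<open>With \<open>c = a b\<close>, the Binet formula
  \<open>F\<^sub>n = a\<^bsup>[n even]\<^esup> c\<^bsup>-\<lfloor>n/2\<rfloor>\<^esup> (\<alpha>\<^sup>n - \<beta>\<^sup>n) / (\<alpha> - \<beta>)\<close> follows from the recurrence because both roots
  satisfy \<open>x\<^sup>2 = c x + c\<close>. Reading it off at \<open>n, n+1, n+2, n+3\<close> gives the coefficients of \<open>Q\<^sub>n\<close>:
  the powers of \<open>c\<close> and the parity-dependent factor \<open>a\<close> are those collected in the starred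
  quaternions.\<close>

lemma power_add_2_of_quadratic:
  fixes x :: "'a::comm_ring_1"
  assumes "x ^ 2 - c * x - c = 0"
  shows "x ^ Suc (Suc n) = c * x ^ Suc n + c * x ^ n"
proof -
  have "x ^ 2 = c * x + c"
    using assms by (simp add: algebra_simps)
  then have "x ^ n * x ^ 2 = x ^ n * (c * x + c)"
    by simp
  then show ?thesis
    by (simp add: power2_eq_square algebra_simps)
qed

lemma biperiodic_fib_binet:
  fixes a b :: real and \<alpha> \<beta> :: complex
  assumes "a * b \<noteq> 0" "\<alpha> \<noteq> \<beta>"
    and \<alpha>: "\<alpha> ^ 2 - of_real (a * b) * \<alpha> - of_real (a * b) = 0"
    and \<beta>: "\<beta> ^ 2 - of_real (a * b) * \<beta> - of_real (a * b) = 0"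
  shows "complex_of_real (biperiodic_fib a b n) =
    (if even n then of_real a else 1) / of_real (a * b) ^ (n div 2) * (\<alpha> ^ n - \<beta> ^ n) / (\<alpha> - \<beta>)"
proof -
  define c where "c = complex_of_real (a * b)"
  define G where "G n = (\<alpha> ^ n - \<beta> ^ n) / (\<alpha> - \<beta>)" for n
  have "c \<noteq> 0" and ab: "complex_of_real a * of_real b = c"
    using assms(1) by (simp_all add: c_def)
  have G: "G (Suc (Suc n)) = c * (G (Suc n) + G n)" for n
    unfolding G_def power_add_2_of_quadratic[OF \<alpha>[folded c_def]]
      power_add_2_of_quadratic[OF \<beta>[folded c_def]]
    by (simp add: algebra_simps add_divide_distrib diff_divide_distrib)
  have "complex_of_real (biperiodic_fib a b n) =
      (if even n then of_real a else 1) / c ^ (n div 2) * G n"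
  proof (induction n rule: induct_nat_012)
    case (ge2 n)
    show ?case
    proof (cases "even n")
      case True
      \<comment> \<open>Both terms of \<open>a * F (n + 1) + F n\<close> carry the factor
        \<open>a / c ^ (n div 2)\<close>: the first gets its \<open>a\<close> from the recurrence,
        the second from the formula.\<close>
      then have "Suc n div 2 = n div 2" by presburger
      with True ge2 \<open>c \<noteq> 0\<close> show ?thesis
        by (simp add: G field_simps)
    next
      case False
      \<comment> \<open>Here \<open>F (n + 1)\<close> has one more \<open>c\<close> in its
        denominator and a factor \<open>a\<close>; since \<open>b * a = c\<close>, the coefficient
        \<open>b\<close> cancels both.\<close>
      then have "Suc n div 2 = Suc (n div 2)" by presburger
      with False ge2 \<open>c \<noteq> 0\<close> show ?thesis
        by (simp add: G field_simps flip: ab)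
    qed
  qed (use assms(2) in \<open>simp_all add: G_def\<close>)
  then show ?thesis
    by (simp add: G_def c_def)
qed

text \<open>The discriminant is \<open>c * (c + 4)\<close>. A set equation with
  \<open>{\<alpha>, \<beta>}\<close> still allows a double root, so this has to be excluded.\<close>

lemma distinct_roots:
  fixes c \<alpha> \<beta> :: complex
  assumes "c \<noteq> 0" "c \<noteq> - 4" and roots: "{x. x ^ 2 - c * x - c = 0} = {\<alpha>, \<beta>}"
  shows "\<alpha> \<noteq> \<beta>"
proof
  assume "\<alpha> = \<beta>"
  have \<alpha>: "\<alpha> ^ 2 - c * \<alpha> - c = 0"
    using roots by blast
  \<comment> \<open>By Vieta, \<open>c - \<alpha>\<close> is the other root, so it must be \<alpha>
    again if the root set is a singleton.\<close>
  then have "(c - \<alpha>) ^ 2 - c * (c - \<alpha>) - c = 0"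
    by (simp add: power2_eq_square algebra_simps)
  then have "c - \<alpha> = \<alpha>"
    using roots \<open>\<alpha> = \<beta>\<close> by blast
  then have "c = 2 * \<alpha>"
    by (simp add: algebra_simps)
  then have "\<alpha> * (\<alpha> + 2) = - (\<alpha> ^ 2 - c * \<alpha> - c)"
    by (simp add: power2_eq_square algebra_simps)
  with \<alpha> have "\<alpha> * (\<alpha> + 2) = 0"
    by simp
  then have "\<alpha> = 0 \<or> \<alpha> = - 2"
    by (simp add: add_eq_0_iff2)
  with \<open>c = 2 * \<alpha>\<close> assms(1,2) show False
    by auto
qed

lemma biperiodic_fib_quat_binet:
  fixes a b :: real and \<alpha> \<beta> :: complex and n :: nat
  assumes "a * b \<noteq> 0" "\<alpha> \<noteq> \<beta>"
    and "\<alpha> ^ 2 - of_real (a * b) * \<alpha> - of_real (a * b) = 0"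
    and "\<beta> ^ 2 - of_real (a * b) * \<beta> - of_real (a * b) = 0"
  defines "s \<equiv> if even n then star_quat a b else star_star_quat a b"
  shows "map_quaternion complex_of_real (biperiodic_fib_quat a b n) =
    (1 / of_real (a * b) ^ (n div 2)) *\<^sub>Q (1 / (\<alpha> - \<beta>)) *\<^sub>Q (\<alpha> ^ n *\<^sub>Q s \<alpha> - \<beta> ^ n *\<^sub>Q s \<beta>)"
proof -
  define c where "c = complex_of_real (a * b)"
  define d where "d = \<alpha> - \<beta>"
  note binet = biperiodic_fib_binet[OF assms(1-4), folded c_def d_def]
  \<comment> \<open>Relative to \<open>c ^ (n div 2)\<close>, the extra powers of \<open>c\<close>
    are 0, 1, 1 for even \<open>n\<close> and 1, 1, 2 for odd \<open>n\<close>: the denominators at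
    \<open>qi\<close>, \<open>qj\<close>, \<open>qk\<close> in the starred quaternions.\<close>
  have div: "Suc n div 2 = (if even n then n div 2 else Suc (n div 2))"
    "Suc (Suc n) div 2 = Suc (n div 2)"
    "Suc (Suc (Suc n)) div 2 = (if even n then Suc (n div 2) else Suc (Suc (n div 2)))"
    by presburger+
  have coeffs: "biperiodic_fib_quat a b n = Quat (biperiodic_fib a b n) (biperiodic_fib a b (Suc n))
      (biperiodic_fib a b (Suc (Suc n))) (biperiodic_fib a b (Suc (Suc (Suc n))))"
    unfolding biperiodic_fib_quat_def quaternion_basis by (simp add: numeral_eq_Suc)
  show ?thesis
    unfolding coeffs s_def star_quat_def star_star_quat_def c_def[symmetric] d_def[symmetric]
    \<comment> \<open>The recurrence is switched off so that the Binet formula applies to each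
      shifted index directly.\<close>
    by (cases "even n")
      (simp_all add: binet div scaleQ_def quat_of_def qi_def qj_def qk_def quaternion_defs
        del: biperiodic_fib.simps,
       simp_all add: divide_inverse algebra_simps power2_eq_square power3_eq_cube)
qed

lemma complexify_biperiodic_dual_fib_quat:
  "complexify (biperiodic_dual_fib_quat a b n) =
    dual_of (map_quaternion complex_of_real (biperiodic_fib_quat a b n))
    + \<epsilon> * dual_of (map_quaternion complex_of_real (biperiodic_fib_quat a b (n + 1)))"
  by (simp add: biperiodic_dual_fib_quat_def complexify_def flip: dual_number_basis)

theorem theorem3p1:
  fixes a b :: real and \<alpha> \<beta> :: complex and n :: nat
  assumes "a \<noteq> 0" and "b \<noteq> 0" and "a * b \<noteq> -4"
    and roots: "{x :: complex. x ^ 2 - of_real (a * b) * x - of_real (a * b) = 0} = {\<alpha>, \<beta>}"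
  shows
    "(even n \<longrightarrow>
        complexify (biperiodic_dual_fib_quat a b n) =
          dual_of ((1 / of_real (a * b) ^ (n div 2)) *\<^sub>Q (1 / (\<alpha> - \<beta>)) *\<^sub>Q
            (\<alpha> ^ n *\<^sub>Q star_quat a b \<alpha> - \<beta> ^ n *\<^sub>Q star_quat a b \<beta>))
          + \<epsilon> * dual_of ((1 / of_real (a * b) ^ ((n + 1) div 2)) *\<^sub>Q (1 / (\<alpha> - \<beta>)) *\<^sub>Q
            (\<alpha> ^ (n + 1) *\<^sub>Q star_star_quat a b \<alpha> - \<beta> ^ (n + 1) *\<^sub>Q star_star_quat a b \<beta>)))
     \<and> (odd n \<longrightarrow>
        complexify (biperiodic_dual_fib_quat a b n) =
          dual_of ((1 / of_real (a * b) ^ (n div 2)) *\<^sub>Q (1 / (\<alpha> - \<beta>)) *\<^sub>Q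
            (\<alpha> ^ n *\<^sub>Q star_star_quat a b \<alpha> - \<beta> ^ n *\<^sub>Q star_star_quat a b \<beta>))
          + \<epsilon> * dual_of ((1 / of_real (a * b) ^ ((n + 1) div 2)) *\<^sub>Q (1 / (\<alpha> - \<beta>)) *\<^sub>Q
            (\<alpha> ^ (n + 1) *\<^sub>Q star_quat a b \<alpha> - \<beta> ^ (n + 1) *\<^sub>Q star_quat a b \<beta>)))"
proof -
  have "a * b \<noteq> 0"
    using assms(1,2) by simp
  have "\<alpha> \<noteq> \<beta>"
    using distinct_roots[OF _ _ roots] \<open>a * b \<noteq> 0\<close> assms(3)
    by (metis of_real_eq_0_iff of_real_eq_iff of_real_minus of_real_numeral)
  moreover have "\<alpha> ^ 2 - of_real (a * b) * \<alpha> - of_real (a * b) = 0"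
    and "\<beta> ^ 2 - of_real (a * b) * \<beta> - of_real (a * b) = 0"
    using roots by blast+
  \<comment> \<open>The dual part is the quaternion formula at \<open>n + 1\<close>, whose parity is
    opposite; hence the two starred quaternions swap.\<close>
  ultimately show ?thesis
    using biperiodic_fib_quat_binet[OF \<open>a * b \<noteq> 0\<close>]
    by (simp add: complexify_biperiodic_dual_fib_quat del: of_real_mult)
qed

end
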